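(* Consider the optimal control problem $$J = \inf_{u(\cdot)} \int_{t_i}^{t_f} h(t,x(t),u(t))\,dt \quad \text{s.t.} \quad \dot x(t) = f(t,x(t),u(t)),\ \ x(t_i) = x_i,\ x(t_f) = x_f,\ \ x(t)\in\mathbf{X},\ u(t)\in\mathbf{U},\ t \in \mathbf{T} := [t_i,t_f],$$ where $t_i<t_f$ and $x_i,x_f\in\mathbb{R}^n$ are given, $x(t)\in\mathbb{R}^n$, $u(t)\in\mathbb{R}^m$, $h$ and the components of $f$ are real polynomials in $(t,\underline{x},\underline{u})$, and $\mathbf{X}\subset\mathbb{R}^n$, $\mathbf{U}\subset\mathbb{R}^m$ are compact basic semi-algebraic sets, each contained in a ball whose defining inequality is included in the algebraic description of the set. Let $J^r_{SDP}$ denote the optimal value of the moment (semi-definite) relaxation of order $r$ of this problem. If an admissible pair $(u(t),x(t))$ has the same cost as a moment relaxation, i.e. $\int_{t_i}^{t_f} h(t,x(t),u(t))\,dt = J^r_{SDP}$ for some $r$, then $(u(t),x(t))$ is globally optimal for the optimal control problem.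
   Context: A pair $(u(\cdot),x(\cdot))$ is admissible if $u$ is measurable, $x$ is absolutely continuous, and all constraints of the optimal control problem hold (the differential equation and control constraint for almost every $t$). A set is basic semi-algebraic if it is defined by finitely many polynomial inequalities $g_j \ge 0$. Measure linear program: $$J_{LP} = \inf_\mu \int h\,d\mu \quad\text{s.t.}\quad v(t_f,x_f) - v(t_i,x_i) = \int \Big(\frac{\partial v}{\partial t} + \frac{\partial v}{\partial \underline{x}} f\Big) d\mu \ \ \forall v\in\mathbb{R}[t,\underline{x}],\qquad \mu\in\mathcal{M}^+(\mathbf{T}\times\mathbf{U}\times\mathbf{X}),$$ where $\mathcal{M}^+(K)$ denotes the finite positive Borel measures supported on $K$. Moment relaxation of order $r$: this is the finite-dimensional truncation of the measure linear program involving only moments of degree up to $2r$. Its decision variable is a real sequence $y=(y_\alpha)$ indexed by $\alpha\in\mathbb{N}^{1+m+n}$ with $|\alpha|\le 2r$. Write $z=(t,\underline{u},\underline{x})$ and let $L_y$ be the linear functional on polynomials of degree at most $2r$ with $L_y(z^\alpha)=y_\alpha$. Then $J^r_{SDP}$ is the infimum of $L_y(h)$ over all $y$ such that: (i) $L_y\big(\frac{\partial v}{\partial t} + \frac{\partial v}{\partial \underline{x}} f\big) = v(t_f,x_f)-v(t_i,x_i)$ for all monomials $v$ in $(t,\underline{x})$ for which $\frac{\partial v}{\partial t} + \frac{\partial v}{\partial \underline{x}} f$ has degree at most $2r$; (ii) $L_y(p^2)\ge 0$ for all polynomials $p$ in $z$ of degree at most $r$; (iii) $L_y(g\,p^2)\ge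 0$ for every polynomial $g$ among the defining inequalities $g\ge0$ of $\mathbf{U}$, of $\mathbf{X}$ and of $\mathbf{T}$ (with $\mathbf{T}$ described by $(t-t_i)(t_f-t)\ge 0$) and all polynomials $p$ in $z$ of degree at most $r-\lceil \deg g/2\rceil$. Here $r$ is taken large enough that $h$ and all the polynomials $g$ have degree at most $2r$. *)

theory Defs
  imports "HOL-Analysis.Analysis" "HOL-Library.Poly_Mapping"
begin

section \<open>Real polynomials in an arbitrary set of indeterminates\<close>

text \<open>
  A monomial is a finitely supported exponent vector and a polynomial is a finitely supported
  coefficient function on monomials; the ring structure (convolution product) is that of
  \<^theory>\<open>HOL-Library.Poly_Mapping\<close>.
\<close>

type_synonym 'k monomial = "'k \<Rightarrow>\<^sub>0 nat"
type_synonym 'k mpoly = "'k monomial \<Rightarrow>\<^sub>0 real"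

definition const_poly :: "real \<Rightarrow> 'k mpoly" where
  "const_poly c = Poly_Mapping.single 0 c"

definition var_poly :: "'k \<Rightarrow> 'k mpoly" where
  "var_poly k = Poly_Mapping.single (Poly_Mapping.single k 1) 1"

definition monom_poly :: "'k monomial \<Rightarrow> 'k mpoly" where
  "monom_poly \<alpha> = Poly_Mapping.single \<alpha> 1"

definition poly_vars :: "'k mpoly \<Rightarrow> 'k set" where
  "poly_vars p = (\<Union>\<alpha>\<in>Poly_Mapping.keys p. Poly_Mapping.keys \<alpha>)"

definition peval :: "'k mpoly \<Rightarrow> ('k \<Rightarrow> real) \<Rightarrow> real" where
  "peval p z = (\<Sum>\<alpha>\<in>Poly_Mapping.keys p. Poly_Mapping.lookup p \<alpha> *
     (\<Prod>k\<in>Poly_Mapping.keys \<alpha>. z k ^ Poly_Mapping.lookup \<alpha> k))"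

definition monom_deg :: "'k monomial \<Rightarrow> nat" where
  "monom_deg \<alpha> = (\<Sum>k\<in>Poly_Mapping.keys \<alpha>. Poly_Mapping.lookup \<alpha> k)"

text \<open>Total degree; the zero polynomial has degree 0.\<close>

definition poly_deg :: "'k mpoly \<Rightarrow> nat" where
  "poly_deg p = Max (insert 0 (monom_deg ` Poly_Mapping.keys p))"

text \<open>
  Formal partial derivative. The subtraction of exponents truncates only where the coefficient
  vanishes.
\<close>

definition partial :: "'k \<Rightarrow> 'k mpoly \<Rightarrow> 'k mpoly" where
  "partial k p = (\<Sum>\<alpha>\<in>Poly_Mapping.keys p.
     Poly_Mapping.single (\<alpha> - Poly_Mapping.single k 1)
       (real (Poly_Mapping.lookup \<alpha> k) * Poly_Mapping.lookup p \<alpha>))"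


section \<open>Absolutely continuous functions\<close>

definition absolutely_continuous_on_interval ::
    "real \<Rightarrow> real \<Rightarrow> (real \<Rightarrow> 'a::real_normed_vector) \<Rightarrow> bool" where
  "absolutely_continuous_on_interval a b x \<longleftrightarrow>
    (\<forall>\<epsilon>>0. \<exists>\<delta>>0. \<forall>D :: (real \<times> real) set.
       finite D \<longrightarrow>
       (\<forall>(s, s')\<in>D. a \<le> s \<and> s \<le> s' \<and> s' \<le> b) \<longrightarrow>
       disjoint_family_on (\<lambda>(s, s'). {s<..<s'}) D \<longrightarrow>
       (\<Sum>(s, s')\<in>D. s' - s) < \<delta> \<longrightarrow>
       (\<Sum>(s, s')\<in>D. norm (x s' - x s)) < \<epsilon>)"


section \<open>The optimal control problem\<close>

text \<open>The components of $z = (t, u, x)$ with $u \in R^m$ and $x \in R^n$.\<close>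

datatype ('m, 'n) coord = Time | Control 'm | State 'n

primrec point :: "real \<Rightarrow> real ^ 'm \<Rightarrow> real ^ 'n \<Rightarrow> ('m, 'n) coord \<Rightarrow> real" where
  "point t u x Time = t"
| "point t u x (Control i) = u $ i"
| "point t u x (State i) = x $ i"

text \<open>
  All polynomials live in the one ring of polynomials in $z$. The fields \<open>U_ineqs\<close> and \<open>X_ineqs\<close>
  hold the polynomials $g$ of the inequalities $g \ge 0$ describing the two constraint sets.
\<close>

record ('m, 'n) ocp =
  t_init :: real
  t_final :: real
  x_init :: "real ^ 'n"
  x_final :: "real ^ 'n"
  cost_poly :: "('m, 'n) coord mpoly"
  dyn_poly :: "'n \<Rightarrow> ('m, 'n) coord mpoly"
  U_ineqs :: "('m, 'n) coord mpoly set"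
  X_ineqs :: "('m, 'n) coord mpoly set"

text \<open>
  The inequalities of \<open>U_set\<close> and \<open>X_set\<close> are to involve only the control and only the state
  indeterminates, respectively, so the value 0 given to the other components is immaterial.
\<close>

definition U_set :: "('m::finite, 'n::finite) ocp \<Rightarrow> (real ^ 'm) set" where
  "U_set P = {u. \<forall>g\<in>U_ineqs P. 0 \<le> peval g (point 0 u 0)}"

definition X_set :: "('m::finite, 'n::finite) ocp \<Rightarrow> (real ^ 'n) set" where
  "X_set P = {x. \<forall>g\<in>X_ineqs P. 0 \<le> peval g (point 0 0 x)}"

text \<open>The polynomials $\rho^2 - |u - c|^2$ and $\rho^2 - |x - c|^2$.\<close>

definition control_ball_poly :: "real ^ 'm \<Rightarrow> real \<Rightarrow> ('m::finite, 'n) coord mpoly" where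
  "control_ball_poly c \<rho> =
     const_poly (\<rho>\<^sup>2) - (\<Sum>i\<in>UNIV. (var_poly (Control i) - const_poly (c $ i))\<^sup>2)"

definition state_ball_poly :: "real ^ 'n \<Rightarrow> real \<Rightarrow> ('m, 'n::finite) coord mpoly" where
  "state_ball_poly c \<rho> =
     const_poly (\<rho>\<^sup>2) - (\<Sum>i\<in>UNIV. (var_poly (State i) - const_poly (c $ i))\<^sup>2)"

definition admissible ::
    "('m::finite, 'n::finite) ocp \<Rightarrow> (real \<Rightarrow> real ^ 'm) \<Rightarrow> (real \<Rightarrow> real ^ 'n) \<Rightarrow> bool" where
  "admissible P u x \<longleftrightarrow>
     u \<in> borel_measurable (lebesgue_on {t_init P..t_final P}) \<and>
     absolutely_continuous_on_interval (t_init P) (t_final P) x \<and>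
     (AE t in lebesgue_on {t_init P..t_final P}.
        (x has_vector_derivative (\<chi> i. peval (dyn_poly P i) (point t (u t) (x t))))
          (at t within {t_init P..t_final P})) \<and>
     x (t_init P) = x_init P \<and>
     x (t_final P) = x_final P \<and>
     (\<forall>t\<in>{t_init P..t_final P}. x t \<in> X_set P) \<and>
     (AE t in lebesgue_on {t_init P..t_final P}. u t \<in> U_set P)"

text \<open>
  For an admissible pair and compact \<open>U_set\<close>, the integrand is measurable and essentially bounded,
  so the integral exists.
\<close>

definition cost ::
    "('m::finite, 'n::finite) ocp \<Rightarrow> (real \<Rightarrow> real ^ 'm) \<Rightarrow> (real \<Rightarrow> real ^ 'n) \<Rightarrow> real" where
  "cost P u x =
     (LINT t|lebesgue_on {t_init P..t_final P}. peval (cost_poly P) (point t (u t) (x t)))"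

definition J_opt :: "('m::finite, 'n::finite) ocp \<Rightarrow> ereal" where
  "J_opt P = Inf {ereal (cost P u x) | u x. admissible P u x}"

definition globally_optimal ::
    "('m::finite, 'n::finite) ocp \<Rightarrow> (real \<Rightarrow> real ^ 'm) \<Rightarrow> (real \<Rightarrow> real ^ 'n) \<Rightarrow> bool" where
  "globally_optimal P u x \<longleftrightarrow> admissible P u x \<and> ereal (cost P u x) = J_opt P"


section \<open>The moment relaxations\<close>

definition T_poly :: "('m, 'n::finite) ocp \<Rightarrow> ('m, 'n) coord mpoly" where
  "T_poly P = (var_poly Time - const_poly (t_init P)) * (const_poly (t_final P) - var_poly Time)"

definition constraint_polys :: "('m, 'n::finite) ocp \<Rightarrow> ('m, 'n) coord mpoly set" where
  "constraint_polys P = U_ineqs P \<union> X_ineqs P \<union> {T_poly P}"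

text \<open>$\partial v / \partial t + (\partial v / \partial x) f$\<close>

definition liouville :: "('m, 'n::finite) ocp \<Rightarrow> ('m, 'n) coord mpoly \<Rightarrow> ('m, 'n) coord mpoly" where
  "liouville P v = partial Time v + (\<Sum>i\<in>UNIV. partial (State i) v * dyn_poly P i)"

definition riesz :: "('k monomial \<Rightarrow> real) \<Rightarrow> 'k mpoly \<Rightarrow> real" where
  "riesz y p = (\<Sum>\<alpha>\<in>Poly_Mapping.keys p. Poly_Mapping.lookup p \<alpha> * y \<alpha>)"

text \<open>
  The decision variable is indexed by the monomials of degree at most $2r$ only: outside of them
  \<open>y\<close> is \<open>undefined\<close>. The functional \<open>riesz y\<close> is applied only to polynomials of degree at most $2r$.
\<close>

definition moment_feasible ::
    "('m::finite, 'n::finite) ocp \<Rightarrow> nat \<Rightarrow> (('m, 'n) coord monomial \<Rightarrow> real) set" where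
  "moment_feasible P r = {y \<in> extensional {\<alpha>. monom_deg \<alpha> \<le> 2 * r}.
     (\<forall>\<alpha>. let v = monom_poly \<alpha> in
        Poly_Mapping.keys \<alpha> \<subseteq> insert Time (range State) \<longrightarrow>
        poly_deg (liouville P v) \<le> 2 * r \<longrightarrow>
        riesz y (liouville P v) =
          peval v (point (t_final P) 0 (x_final P)) - peval v (point (t_init P) 0 (x_init P))) \<and>
     (\<forall>p. poly_deg p \<le> r \<longrightarrow> 0 \<le> riesz y (p\<^sup>2)) \<and>
     (\<forall>g\<in>constraint_polys P. \<forall>p.
        poly_deg p \<le> r - nat \<lceil>real (poly_deg g) / 2\<rceil> \<longrightarrow> 0 \<le> riesz y (g * p\<^sup>2))}"

definition J_SDP :: "('m::finite, 'n::finite) ocp \<Rightarrow> nat \<Rightarrow> ereal" where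
  "J_SDP P r = (INF y\<in>moment_feasible P r. ereal (riesz y (cost_poly P)))"

end

theory Submission
  imports Defs
begin

text \<open>
  The occupation measure of any admissible pair, i.e. the image of Lebesgue measure on the time
  interval under \<open>t \<mapsto> (t, u t, x t)\<close>, has moments that are feasible for every relaxation and at
  which the relaxed cost is the cost of the pair: the sum-of-squares conditions integrate nonnegative
  functions, and the linear conditions are the fundamental theorem of calculus for the absolutely
  continuous functions \<open>t \<mapsto> v (t, x t)\<close>. Hence each relaxation bounds the optimal value from
  below, and a pair that attains this bound is optimal.
\<close>

section \<open>Absolutely continuous functions\<close>

lemma absolutely_continuous_on_intervalE:
  assumes "absolutely_continuous_on_interval a b f" "\<epsilon> > 0"
  obtains \<delta> where "\<delta> > 0"
    "\<And>D. \<lbrakk>finite D; \<And>s s'. (s, s') \<in> D \<Longrightarrow> a \<le> s \<and> s \<le> s' \<and> s' \<le> b;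
       disjoint_family_on (\<lambda>(s, s'). {s<..<s'}) D; (\<Sum>(s, s')\<in>D. s' - s) < \<delta>\<rbrakk>
      \<Longrightarrow> (\<Sum>(s, s')\<in>D. norm (f s' - f s)) < \<epsilon>"
proof -
  obtain \<delta> where "\<delta> > 0" and \<delta>: "\<forall>D. finite D \<longrightarrow> (\<forall>(s, s')\<in>D. a \<le> s \<and> s \<le> s' \<and> s' \<le> b) \<longrightarrow>
      disjoint_family_on (\<lambda>(s, s'). {s<..<s'}) D \<longrightarrow> (\<Sum>(s, s')\<in>D. s' - s) < \<delta> \<longrightarrow>
      (\<Sum>(s, s')\<in>D. norm (f s' - f s)) < \<epsilon>"
    using assms unfolding absolutely_continuous_on_interval_def by blast
  show thesis
    by (rule that[OF \<open>\<delta> > 0\<close>], rule \<delta>[rule_format]) auto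
qed

text \<open>The smaller of the two \<delta> serves both dominating functions at once. The closure
  properties below use this in place of a separate epsilon-delta argument for each of them.\<close>

lemma absolutely_continuous_on_interval_dominated:
  assumes f: "absolutely_continuous_on_interval a b f"
    and g: "absolutely_continuous_on_interval a b g"
    and dom: "\<And>s s'. \<lbrakk>a \<le> s; s \<le> s'; s' \<le> b\<rbrakk> \<Longrightarrow>
      norm (w s' - w s) \<le> C * (norm (f s' - f s) + norm (g s' - g s))"
  shows "absolutely_continuous_on_interval a b w"
  unfolding absolutely_continuous_on_interval_def
proof (intro allI impI)
  fix \<epsilon> :: real assume "\<epsilon> > 0"
  \<comment> \<open>\<open>C\<close> may be zero or negative; \<open>K\<close> is at least 1, so
    \<eta> is positive and \<open>K * (\<eta> + \<eta>)\<close> is exactly \<epsilon>.\<close>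
  define K where "K = max C 1"
  have K: "K \<ge> 1" "C \<le> K" by (auto simp: K_def)
  define \<eta> where "\<eta> = \<epsilon> / (2 * K)"
  have \<eta>: "\<eta> > 0" using \<open>\<epsilon> > 0\<close> K by (simp add: \<eta>_def)
  obtain \<delta>1 where \<delta>1: "\<delta>1 > 0"
    "\<And>D. \<lbrakk>finite D; \<And>s s'. (s, s') \<in> D \<Longrightarrow> a \<le> s \<and> s \<le> s' \<and> s' \<le> b;
       disjoint_family_on (\<lambda>(s, s'). {s<..<s'}) D; (\<Sum>(s, s')\<in>D. s' - s) < \<delta>1\<rbrakk>
      \<Longrightarrow> (\<Sum>(s, s')\<in>D. norm (f s' - f s)) < \<eta>"
    using absolutely_continuous_on_intervalE[OF f \<eta>] by blast
  obtain \<delta>2 where \<delta>2: "\<delta>2 > 0"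
    "\<And>D. \<lbrakk>finite D; \<And>s s'. (s, s') \<in> D \<Longrightarrow> a \<le> s \<and> s \<le> s' \<and> s' \<le> b;
       disjoint_family_on (\<lambda>(s, s'). {s<..<s'}) D; (\<Sum>(s, s')\<in>D. s' - s) < \<delta>2\<rbrakk>
      \<Longrightarrow> (\<Sum>(s, s')\<in>D. norm (g s' - g s)) < \<eta>"
    using absolutely_continuous_on_intervalE[OF g \<eta>] by blast
  show "\<exists>\<delta>>0. \<forall>D. finite D \<longrightarrow> (\<forall>(s, s')\<in>D. a \<le> s \<and> s \<le> s' \<and> s' \<le> b) \<longrightarrow>
      disjoint_family_on (\<lambda>(s, s'). {s<..<s'}) D \<longrightarrow> (\<Sum>(s, s')\<in>D. s' - s) < \<delta> \<longrightarrow>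
      (\<Sum>(s, s')\<in>D. norm (w s' - w s)) < \<epsilon>"
  proof (intro exI[of _ "min \<delta>1 \<delta>2"] conjI allI impI)
    fix D :: "(real \<times> real) set"
    assume D: "finite D" "\<forall>(s, s')\<in>D. a \<le> s \<and> s \<le> s' \<and> s' \<le> b"
      "disjoint_family_on (\<lambda>(s, s'). {s<..<s'}) D" "(\<Sum>(s, s')\<in>D. s' - s) < min \<delta>1 \<delta>2"
    have "(\<Sum>(s, s')\<in>D. norm (w s' - w s))
        \<le> (\<Sum>(s, s')\<in>D. K * (norm (f s' - f s) + norm (g s' - g s)))"
    proof (intro sum_mono, clarify)
      fix s s' assume "(s, s') \<in> D"
      then have "norm (w s' - w s) \<le> C * (norm (f s' - f s) + norm (g s' - g s))"
        using D(2) by (intro dom) auto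
      also have "\<dots> \<le> K * (norm (f s' - f s) + norm (g s' - g s))"
        using K by (intro mult_right_mono) auto
      finally show "norm (w s' - w s) \<le> K * (norm (f s' - f s) + norm (g s' - g s))" .
    qed
    also have "\<dots> = K * ((\<Sum>(s, s')\<in>D. norm (f s' - f s)) + (\<Sum>(s, s')\<in>D. norm (g s' - g s)))"
      by (simp add: sum_distrib_left sum.distrib case_prod_unfold distrib_left)
    also have "\<dots> < K * (\<eta> + \<eta>)"
    proof -
      have "(\<Sum>(s, s')\<in>D. norm (f s' - f s)) < \<eta>" using D by (intro \<delta>1(2)) auto
      moreover have "(\<Sum>(s, s')\<in>D. norm (g s' - g s)) < \<eta>" using D by (intro \<delta>2(2)) auto
      ultimately show ?thesis using K by (intro mult_strict_left_mono) auto
    qed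
    also have "\<dots> = \<epsilon>" using K by (simp add: \<eta>_def)
    finally show "(\<Sum>(s, s')\<in>D. norm (w s' - w s)) < \<epsilon>" .
  qed (use \<delta>1(1) \<delta>2(1) in auto)
qed

lemma absolutely_continuous_on_interval_ident:
  "absolutely_continuous_on_interval a b (\<lambda>t. t :: real)"
  unfolding absolutely_continuous_on_interval_def
proof (intro allI impI)
  fix \<epsilon> :: real assume "\<epsilon> > 0"
  have "(\<Sum>(s, s')\<in>D. norm (s' - s)) = (\<Sum>(s, s')\<in>D. s' - s)"
    if "\<forall>(s, s')\<in>D. a \<le> s \<and> s \<le> s' \<and> s' \<le> b" for D
    using that by (intro sum.cong) auto
  then show "\<exists>\<delta>>0. \<forall>D. finite D \<longrightarrow> (\<forall>(s, s')\<in>D. a \<le> s \<and> s \<le> s' \<and> s' \<le> b) \<longrightarrow>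
      disjoint_family_on (\<lambda>(s, s'). {s<..<s'}) D \<longrightarrow> (\<Sum>(s, s')\<in>D. s' - s) < \<delta> \<longrightarrow>
      (\<Sum>(s, s')\<in>D. norm (s' - s)) < \<epsilon>"
    using \<open>\<epsilon> > 0\<close> by (intro exI[of _ \<epsilon>]) auto
qed

lemma absolutely_continuous_on_interval_const:
  "absolutely_continuous_on_interval a b (\<lambda>_. c)"
  by (rule absolutely_continuous_on_interval_dominated[OF
        absolutely_continuous_on_interval_ident absolutely_continuous_on_interval_ident, where C=1]) auto

lemma absolutely_continuous_on_interval_vec_nth:
  fixes x :: "real \<Rightarrow> real ^ 'n"
  assumes "absolutely_continuous_on_interval a b x"
  shows "absolutely_continuous_on_interval a b (\<lambda>t. x t $ i)"
proof (rule absolutely_continuous_on_interval_dominated[OF assms assms, where C=1])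
  show "norm (x s' $ i - x s $ i) \<le> 1 * (norm (x s' - x s) + norm (x s' - x s))" for s s'
    using component_le_norm_cart[of "x s' - x s" i] by simp
qed

text \<open>A family consisting of a single interval turns absolute continuity into uniform
  continuity.\<close>

lemma absolutely_continuous_on_interval_imp_continuous_on:
  assumes "absolutely_continuous_on_interval a b f"
  shows "continuous_on {a..b} f"
proof (rule continuous_onI)
  fix t \<epsilon> :: real assume t: "t \<in> {a..b}" and "\<epsilon> > 0"
  obtain \<delta> where \<delta>: "\<delta> > 0"
    "\<And>D. \<lbrakk>finite D; \<And>s s'. (s, s') \<in> D \<Longrightarrow> a \<le> s \<and> s \<le> s' \<and> s' \<le> b;
       disjoint_family_on (\<lambda>(s, s'). {s<..<s'}) D; (\<Sum>(s, s')\<in>D. s' - s) < \<delta>\<rbrakk>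
      \<Longrightarrow> (\<Sum>(s, s')\<in>D. norm (f s' - f s)) < \<epsilon>"
    using absolutely_continuous_on_intervalE[OF assms \<open>\<epsilon> > 0\<close>] by blast
  have "dist (f t') (f t) \<le> \<epsilon>" if "t' \<in> {a..b}" "dist t' t < \<delta>" for t'
  proof -
    have *: "norm (f s' - f s) < \<epsilon>" if "a \<le> s" "s \<le> s'" "s' \<le> b" "s' - s < \<delta>" for s s'
      using \<delta>(2)[of "{(s, s')}"] that by (simp add: disjoint_family_on_def)
    show ?thesis
      using *[of t t'] *[of t' t] t that
      by (cases "t \<le> t'") (auto simp: dist_norm norm_minus_commute)
  qed
  then show "\<exists>d>0. \<forall>t'\<in>{a..b}. dist t' t < d \<longrightarrow> dist (f t') (f t) \<le> \<epsilon>"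
    using \<delta>(1) by blast
qed

text \<open>Both factors are continuous, hence bounded, on the compact interval, so the increments
  of the product are dominated by those of the factors.\<close>

lemma absolutely_continuous_on_interval_mult:
  fixes f g :: "real \<Rightarrow> real"
  assumes f: "absolutely_continuous_on_interval a b f"
    and g: "absolutely_continuous_on_interval a b g"
  shows "absolutely_continuous_on_interval a b (\<lambda>t. f t * g t)"
proof -
  have "bounded (f ` {a..b})" "bounded (g ` {a..b})"
    using assms absolutely_continuous_on_interval_imp_continuous_on
    by (blast intro: compact_imp_bounded compact_continuous_image)+
  then obtain B C where B: "\<And>t. t \<in> {a..b} \<Longrightarrow> \<bar>f t\<bar> \<le> B" and C: "\<And>t. t \<in> {a..b} \<Longrightarrow> \<bar>g t\<bar> \<le> C"
    unfolding bounded_iff by (metis image_eqI real_norm_def)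
  show ?thesis
  proof (rule absolutely_continuous_on_interval_dominated[OF f g, where C="max B C"])
    fix s s' assume s: "a \<le> s" "s \<le> s'" "s' \<le> b"
    have "f s' * g s' - f s * g s = (f s' - f s) * g s' + f s * (g s' - g s)"
      by (simp add: algebra_simps)
    then have "norm (f s' * g s' - f s * g s) \<le> \<bar>f s' - f s\<bar> * \<bar>g s'\<bar> + \<bar>f s\<bar> * \<bar>g s' - g s\<bar>"
      by (metis abs_mult abs_triangle_ineq real_norm_def)
    also have "\<dots> \<le> \<bar>f s' - f s\<bar> * max B C + max B C * \<bar>g s' - g s\<bar>"
      using B[of s] C[of s'] s by (intro add_mono mult_left_mono mult_right_mono) auto
    finally show "norm (f s' * g s' - f s * g s) \<le> max B C * (norm (f s' - f s) + norm (g s' - g s))"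
      by (simp add: algebra_simps)
  qed
qed

lemma absolutely_continuous_on_interval_power:
  fixes f :: "real \<Rightarrow> real"
  assumes "absolutely_continuous_on_interval a b f"
  shows "absolutely_continuous_on_interval a b (\<lambda>t. f t ^ n)"
  by (induction n)
    (auto intro: absolutely_continuous_on_interval_const absolutely_continuous_on_interval_mult[OF assms])

lemma absolutely_continuous_on_interval_prod:
  fixes f :: "'i \<Rightarrow> real \<Rightarrow> real"
  assumes "\<And>i. i \<in> A \<Longrightarrow> absolutely_continuous_on_interval a b (f i)"
  shows "absolutely_continuous_on_interval a b (\<lambda>t. \<Prod>i\<in>A. f i t)"
  using assms
  by (induction A rule: infinite_finite_induct)
    (auto intro: absolutely_continuous_on_interval_const absolutely_continuous_on_interval_mult)

section \<open>The fundamental theorem of calculus for absolutely continuous functions\<close>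

text \<open>
  The gauge argument for the fundamental theorem of calculus; the intervals tagged in the null set
  are forced into an open set of small measure, where absolute continuity controls the increments.
\<close>

lemma fundamental_theorem_of_calculus_absolutely_continuous:
  fixes f :: "real \<Rightarrow> 'a::banach"
  assumes "a \<le> b" and ac: "absolutely_continuous_on_interval a b f"
    and N: "negligible N"
    and deriv: "\<And>t. t \<in> {a..b} - N \<Longrightarrow> (f has_vector_derivative f' t) (at t within {a..b})"
  shows "(f' has_integral (f b - f a)) {a..b}"
proof -
  \<comment> \<open>The values of \<open>f'\<close> on \<open>N\<close> are arbitrary and could
    spoil the Riemann sums. With 0 there, tags in \<open>N\<close> contribute only increments of
    \<open>f\<close>.\<close>
  define g where "g t = (if t \<in> N then 0 else f' t)" for t
  have "(g has_integral (f b - f a)) {a..b}"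
    unfolding has_integral_real
  proof (intro allI impI)
    fix \<epsilon> :: real assume "\<epsilon> > 0"
    \<comment> \<open>Half of \<epsilon> is reserved for the tags outside \<open>N\<close>; the
      summand 1 keeps the denominator positive when \<open>a = b\<close>.\<close>
    define e where "e = \<epsilon> / (2 * (b - a + 1))"
    have e: "e > 0" and eb: "e * (b - a) \<le> \<epsilon> / 2" 
      using \<open>a \<le> b\<close> \<open>\<epsilon> > 0\<close> by (auto simp: e_def field_simps)
    have "\<forall>t. \<exists>d>0. t \<in> {a..b} - N \<longrightarrow>
       (\<forall>y\<in>{a..b}. norm (y-t) < d \<longrightarrow> norm (f y - f t - (y-t) *\<^sub>R f' t) \<le> e * norm (y-t))"
      using deriv[unfolded has_vector_derivative_def has_derivative_within_alt] e
      by (metis zero_less_one)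
    then obtain d where d: "\<And>t. 0 < d t" "\<And>t y. \<lbrakk>t \<in> {a..b} - N; y \<in> {a..b}; norm (y-t) < d t\<rbrakk>
        \<Longrightarrow> norm (f y - f t - (y-t) *\<^sub>R f' t) \<le> e * norm (y-t)"
      by metis
    obtain \<delta> where \<delta>: "\<delta> > 0"
      "\<And>D. \<lbrakk>finite D; \<And>s s'. (s, s') \<in> D \<Longrightarrow> a \<le> s \<and> s \<le> s' \<and> s' \<le> b;
         disjoint_family_on (\<lambda>(s, s'). {s<..<s'}) D; (\<Sum>(s, s')\<in>D. s' - s) < \<delta>\<rbrakk>
        \<Longrightarrow> (\<Sum>(s, s')\<in>D. norm (f s' - f s)) < \<epsilon> / 2"
      using absolutely_continuous_on_intervalE[OF ac, of "\<epsilon>/2"] \<open>\<epsilon> > 0\<close> half_gt_zero by blast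
    \<comment> \<open>Outer regularity makes \<open>T - N\<close> small; since \<open>N\<close> is
      null, \<open>T\<close> itself then has measure below \<delta>.\<close>
    obtain T where T: "open T" "N \<subseteq> T" "T - N \<in> lmeasurable" "emeasure lebesgue (T - N) < ennreal \<delta>"
      using sets_lebesgue_outer_open[of N \<delta>] N \<delta>(1) negligible_imp_sets by blast
    have Tm: "T \<in> lmeasurable" and T\<delta>: "measure lebesgue T < \<delta>"
    proof -
      have "T = (T - N) \<union> N" using T(2) by auto
      moreover have "(T - N) \<union> N \<in> lmeasurable"
        using T(3) N negligible_imp_measurable by blast
      ultimately show "T \<in> lmeasurable" by simp
      have "measure lebesgue T = measure lebesgue (T - N)"
        using measure_Un_null_set[of "T - N" lebesgue N] T(3) N \<open>T = (T - N) \<union> N\<close>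
        by (simp add: fmeasurableD negligible_iff_null_sets)
      also have "\<dots> < \<delta>"
        using T(3,4) \<delta>(1) by (simp add: emeasure_eq_measure2 ennreal_less_iff)
      finally show "measure lebesgue T < \<delta>" .
    qed
    \<comment> \<open>Fineness puts each interval tagged in \<open>N\<close> inside
      \<open>T\<close>, and each other interval where the derivative estimate at its tag
      applies.\<close>
    define \<gamma> where "\<gamma> t = (if t \<in> N then T else ball t (d t))" for t
    have gauge: "gauge \<gamma>"
      using T d(1) by (auto simp: gauge_def \<gamma>_def)
    have close: "norm ((\<Sum>(t, K)\<in>p. measure lborel K *\<^sub>R g t) - (f b - f a)) < \<epsilon>"
      if p: "p tagged_division_of {a..b}" and fine: "\<gamma> fine p" for p
    proof -
      have interval: "\<exists>s s'. K = {s..s'} \<and> a \<le> s \<and> s \<le> t \<and> t \<le> s' \<and> s' \<le> b" if "(t, K) \<in> p" for t K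
        using tagged_division_ofD(2,3,4)[OF p that] unfolding box_real by fastforce
      define q where "q = {(t, K) \<in> p. t \<in> N}"
      have "finite p" using p by auto
      have qp: "q \<subseteq> p" "finite q" using \<open>finite p\<close> by (auto simp: q_def intro: finite_subset[OF _ \<open>finite p\<close>])
      have q: "q tagged_division_of (\<Union>(snd ` q))"
        using p qp by (meson tagged_division_of_def tagged_partial_division_of_Union_self tagged_partial_division_subset)
      have diff: "f b - f a = (\<Sum>(t,K)\<in>p. f (Sup K) - f (Inf K))"
        using additive_tagged_division_1[OF \<open>a \<le> b\<close> p, of f] by simp
      \<comment> \<open>The straddle estimate: the tag lies between the endpoints, so its distances
        to them add up to the length of \<open>K\<close>.\<close>
      have good: "norm (measure lborel K *\<^sub>R g t - (f (Sup K) - f (Inf K))) \<le> e * measure lborel K"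
        if "(t, K) \<in> p - q" for t K
      proof -
        have tK: "(t, K) \<in> p" "t \<notin> N" using that by (auto simp: q_def)
        obtain s s' where K: "K = {s..s'}" "a \<le> s" "s \<le> t" "t \<le> s'" "s' \<le> b"
          using interval[OF tK(1)] by blast
        have "K \<subseteq> ball t (d t)" using fineD[OF fine tK(1)] tK(2) by (simp add: \<gamma>_def)
        moreover have "s \<in> K" "s' \<in> K" using K by auto
        ultimately have "s \<in> ball t (d t)" "s' \<in> ball t (d t)" by blast+
        then have near: "norm (s - t) < d t" "norm (s' - t) < d t"
          by (auto simp: dist_real_def)
        have "measure lborel K *\<^sub>R g t - (f (Sup K) - f (Inf K))
            = (f s - f t - (s - t) *\<^sub>R f' t) - (f s' - f t - (s' - t) *\<^sub>R f' t)"
          using K tK by (simp add: g_def algebra_simps)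
        also have "norm \<dots> \<le> norm (f s - f t - (s - t) *\<^sub>R f' t) + norm (f s' - f t - (s' - t) *\<^sub>R f' t)"
          by (rule norm_triangle_ineq4)
        also have "\<dots> \<le> e * norm (s - t) + e * norm (s' - t)"
          using K tK near by (intro add_mono d(2)) auto
        also have "\<dots> = e * measure lborel K"
          using K by (simp add: algebra_simps)
        finally show ?thesis .
      qed
      have "(\<Sum>(t, K)\<in>p. measure lborel K *\<^sub>R g t) - (f b - f a)
          = (\<Sum>(t, K)\<in>p. measure lborel K *\<^sub>R g t - (f (Sup K) - f (Inf K)))"
        by (simp add: diff sum_subtractf case_prod_unfold)
      also have "\<dots> = (\<Sum>(t, K)\<in>p - q. measure lborel K *\<^sub>R g t - (f (Sup K) - f (Inf K)))
          + (\<Sum>(t, K)\<in>q. measure lborel K *\<^sub>R g t - (f (Sup K) - f (Inf K)))"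
        by (rule sum.subset_diff[OF qp(1) \<open>finite p\<close>])
      also have "norm \<dots> \<le> norm (\<Sum>(t, K)\<in>p - q. measure lborel K *\<^sub>R g t - (f (Sup K) - f (Inf K)))
          + norm (\<Sum>(t, K)\<in>q. measure lborel K *\<^sub>R g t - (f (Sup K) - f (Inf K)))"
        by (rule norm_triangle_ineq)
      also have "norm (\<Sum>(t, K)\<in>p - q. measure lborel K *\<^sub>R g t - (f (Sup K) - f (Inf K)))
          \<le> (\<Sum>(t, K)\<in>p - q. e * measure lborel K)"
        using good by (intro sum_norm_le) auto
      also have "\<dots> \<le> (\<Sum>(t, K)\<in>p. e * measure lborel K)"
        using \<open>finite p\<close> e by (intro sum_mono2) auto
      also have "\<dots> = e * (b - a)"
        using additive_content_tagged_division[of p a b] p \<open>a \<le> b\<close>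
        by (simp add: sum_distrib_left[symmetric] case_prod_unfold)
      also have "\<dots> \<le> \<epsilon> / 2" by (rule eb)
      \<comment> \<open>At tags in \<open>N\<close> the function \<open>g\<close> vanishes, which
        leaves only the increments of \<open>f\<close>.\<close>
      also have "norm (\<Sum>(t, K)\<in>q. measure lborel K *\<^sub>R g t - (f (Sup K) - f (Inf K)))
          \<le> (\<Sum>(t, K)\<in>q. norm (f (Sup K) - f (Inf K)))"
        by (intro sum_norm_le) (auto simp: q_def g_def norm_minus_commute)
      also have "\<dots> < \<epsilon> / 2"
      proof -
        \<comment> \<open>Absolute continuity speaks of finite sets of endpoint pairs, so the tagged
          intervals are converted into such pairs.\<close>
        define h where "h = (\<lambda>(t :: real, K :: real set). (Inf K, Sup K))"
        have disj: "{Inf K<..<Sup K} \<inter> {Inf K'<..<Sup K'} = {}"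
          if "(t, K) \<in> p" "(t', K') \<in> p" "(t, K) \<noteq> (t', K')" for t K t' K'
          using tagged_division_ofD(5)[OF p that] interval[OF that(1)] interval[OF that(2)]
          by (auto simp: interior_atLeastAtMost_real)
        \<comment> \<open>Distinct members of \<open>q\<close> with the same endpoints have disjoint
          open intervals, hence degenerate ones; their terms are of the form
          \<open>F s s = 0\<close>, so reindexing loses nothing.\<close>
        have reindex: "(\<Sum>(s, s')\<in>h ` q. F s s') = (\<Sum>(t, K)\<in>q. F (Inf K) (Sup K))"
          if "\<And>s. F s s = 0" for F :: "real \<Rightarrow> real \<Rightarrow> real"
        proof -
          have "(\<Sum>(s, s')\<in>h ` q. F s s') = sum ((\<lambda>(s, s'). F s s') \<circ> h) q"
          proof (rule sum.reindex_nontrivial[OF qp(2)])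
            fix i j assume ij: "i \<in> q" "j \<in> q" "i \<noteq> j" "h i = h j"
            obtain t K t' K' where eq: "i = (t, K)" "j = (t', K')" by fastforce
            have tK: "(t, K) \<in> p" "(t', K') \<in> p" "(t, K) \<noteq> (t', K')"
              using ij(1-3) qp(1) eq by auto
            have "{Inf K<..<Sup K} = {}"
              using disj[OF tK] ij(4) by (simp add: h_def eq)
            moreover have "Inf K \<le> Sup K" using interval[OF tK(1)] by auto
            ultimately show "(case h i of (s, s') \<Rightarrow> F s s') = 0"
              using that by (auto simp: h_def eq)
          qed
          then show ?thesis by (simp add: h_def case_prod_unfold comp_def)
        qed
        \<comment> \<open>The total length is the measure of the union of the intervals, which
          fineness places inside \<open>T\<close>.\<close>
        have "(\<Sum>(t, K)\<in>q. Sup K - Inf K) = (\<Sum>(t, K)\<in>q. measure lborel K)"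
          using interval qp(1) by (intro sum.cong) fastforce+
        also have "\<dots> = sum (measure lborel) (snd ` q)"
        proof (rule sum.over_tagged_division_lemma[OF q])
          show "measure lborel (cbox v w) = 0" if "box v w = {}" for v w :: real
            using that by simp
        qed
        also have "\<dots> = measure lebesgue (\<Union>(snd ` q))"
        proof -
          have "sum (measure lborel) (snd ` q) = sum (measure lebesgue) (snd ` q)"
            using interval qp(1) by (intro sum.cong refl) fastforce
          then show ?thesis
            using content_division[OF division_of_tagged_division[OF q]] by simp
        qed
        also have "\<dots> \<le> measure lebesgue T"
        proof (rule measure_mono_fmeasurable[OF _ _ Tm])
          show "\<Union>(snd ` q) \<subseteq> T"
            using fine by (fastforce simp: q_def fine_def \<gamma>_def)
          show "\<Union>(snd ` q) \<in> sets lebesgue"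
            using division_of_tagged_division[OF q] lmeasurable_division by blast
        qed
        also have "\<dots> < \<delta>" by (rule T\<delta>)
        finally have "(\<Sum>(s, s')\<in>h ` q. s' - s) < \<delta>"
          using reindex[of "\<lambda>s s'. s' - s"] by simp
        then have "(\<Sum>(s, s')\<in>h ` q. norm (f s' - f s)) < \<epsilon> / 2"
        proof (intro \<delta>(2))
          show "a \<le> s \<and> s \<le> s' \<and> s' \<le> b" if "(s, s') \<in> h ` q" for s s'
            using that interval qp(1) by (fastforce simp: h_def)
          show "disjoint_family_on (\<lambda>(s, s'). {s<..<s'}) (h ` q)"
            unfolding disjoint_family_on_def
          proof (intro ballI impI)
            fix i j assume "i \<in> h ` q" "j \<in> h ` q" "i \<noteq> j"
            then show "(case i of (s, s') \<Rightarrow> {s<..<s'}) \<inter> (case j of (s, s') \<Rightarrow> {s<..<s'}) = {}"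
              using disj qp(1) by (fastforce simp: h_def)
          qed
        qed (use qp in auto)
        then show ?thesis
          using reindex[of "\<lambda>s s'. norm (f s' - f s)"] by simp
      qed
      finally show ?thesis by simp
    qed
    show "\<exists>\<gamma>. gauge \<gamma> \<and> (\<forall>p. p tagged_division_of {a..b} \<and> \<gamma> fine p \<longrightarrow>
        norm ((\<Sum>(t, K)\<in>p. measure lborel K *\<^sub>R g t) - (f b - f a)) < \<epsilon>)"
      using gauge by (intro exI[of _ \<gamma>] conjI allI impI close) (auto elim: conjE)
  qed
  \<comment> \<open>\<open>g\<close> and \<open>f'\<close> differ only on the null set
    \<open>N\<close>, which the integral ignores.\<close>
  then show ?thesis
    by (rule has_integral_spike[OF N, rotated]) (simp add: g_def)
qed

section \<open>Evaluation, degree and linear functionals of polynomials\<close>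

definition monom_eval :: "'k monomial \<Rightarrow> ('k \<Rightarrow> real) \<Rightarrow> real" where
  "monom_eval \<alpha> z = (\<Prod>k\<in>Poly_Mapping.keys \<alpha>. z k ^ Poly_Mapping.lookup \<alpha> k)"

lemma monom_eval_superset:
  assumes "finite A" "Poly_Mapping.keys \<alpha> \<subseteq> A"
  shows "monom_eval \<alpha> z = (\<Prod>k\<in>A. z k ^ Poly_Mapping.lookup \<alpha> k)"
  unfolding monom_eval_def using assms
  by (intro prod.mono_neutral_left) (auto simp: in_keys_iff)

lemma monom_eval_zero [simp]: "monom_eval 0 z = 1"
  by (simp add: monom_eval_def)

lemma monom_eval_add: "monom_eval (\<alpha> + \<beta>) z = monom_eval \<alpha> z * monom_eval \<beta> z"
proof -
  let ?A = "Poly_Mapping.keys \<alpha> \<union> Poly_Mapping.keys \<beta>"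
  have "monom_eval (\<alpha> + \<beta>) z = (\<Prod>k\<in>?A. z k ^ Poly_Mapping.lookup (\<alpha> + \<beta>) k)"
    by (rule monom_eval_superset) (simp_all add: keys_add)
  also have "\<dots> = (\<Prod>k\<in>?A. z k ^ Poly_Mapping.lookup \<alpha> k) * (\<Prod>k\<in>?A. z k ^ Poly_Mapping.lookup \<beta> k)"
    by (simp add: lookup_add power_add prod.distrib)
  also have "\<dots> = monom_eval \<alpha> z * monom_eval \<beta> z"
    by (simp add: monom_eval_superset[of ?A])
  finally show ?thesis .
qed

lemma monom_eval_cong:
  assumes "\<And>k. k \<in> Poly_Mapping.keys \<alpha> \<Longrightarrow> z k = z' k"
  shows "monom_eval \<alpha> z = monom_eval \<alpha> z'"
  using assms by (simp add: monom_eval_def)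

section \<open>The Riesz functional and polynomial evaluation\<close>

lemma riesz_superset:
  assumes "finite A" "Poly_Mapping.keys p \<subseteq> A"
  shows "riesz y p = (\<Sum>\<alpha>\<in>A. Poly_Mapping.lookup p \<alpha> * y \<alpha>)"
  unfolding riesz_def using assms
  by (intro sum.mono_neutral_left) (auto simp: in_keys_iff)

lemma riesz_cong:
  assumes "\<And>\<alpha>. \<alpha> \<in> Poly_Mapping.keys p \<Longrightarrow> y \<alpha> = y' \<alpha>"
  shows "riesz y p = riesz y' p"
  using assms by (simp add: riesz_def)

lemma riesz_zero [simp]: "riesz y 0 = 0"
  by (simp add: riesz_def)

lemma riesz_single [simp]: "riesz y (Poly_Mapping.single \<alpha> c) = c * y \<alpha>"
  by (simp add: riesz_def)

lemma riesz_add: "riesz y (p + q) = riesz y p + riesz y q"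
proof -
  let ?A = "Poly_Mapping.keys p \<union> Poly_Mapping.keys q"
  have "riesz y (p + q) = (\<Sum>\<alpha>\<in>?A. Poly_Mapping.lookup (p + q) \<alpha> * y \<alpha>)"
    by (rule riesz_superset) (simp_all add: keys_add)
  also have "\<dots> = riesz y p + riesz y q"
    by (simp add: riesz_superset[of ?A] lookup_add algebra_simps sum.distrib)
  finally show ?thesis .
qed

lemma riesz_diff: "riesz y (p - q) = riesz y p - riesz y q"
  using riesz_add[of y "p - q" q] by simp

lemma riesz_sum: "riesz y (\<Sum>i\<in>I. p i) = (\<Sum>i\<in>I. riesz y (p i))"
  by (induction I rule: infinite_finite_induct) (auto simp: riesz_add)

lemma sum_single_lookup: "(\<Sum>\<alpha>\<in>Poly_Mapping.keys p. Poly_Mapping.single \<alpha> (Poly_Mapping.lookup p \<alpha>)) = p"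
  by (rule poly_mapping_eqI)
    (auto simp: lookup_sum lookup_single when_def sum.delta in_keys_iff)

text \<open>Expanding both factors into monomials reduces the claim to the multiplicativity of
  \<open>y\<close>. The intended \<open>y\<close> is the moment sequence of a point mass.\<close>

lemma riesz_mult:
  assumes "\<And>\<alpha> \<beta>. y (\<alpha> + \<beta>) = y \<alpha> * y \<beta>"
  shows "riesz y (p * q) = riesz y p * riesz y q"
proof -
  have "p * q = (\<Sum>\<alpha>\<in>Poly_Mapping.keys p. Poly_Mapping.single \<alpha> (Poly_Mapping.lookup p \<alpha>))
      * (\<Sum>\<beta>\<in>Poly_Mapping.keys q. Poly_Mapping.single \<beta> (Poly_Mapping.lookup q \<beta>))"
    by (simp only: sum_single_lookup)
  also have "riesz y \<dots> = riesz y p * riesz y q"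
    unfolding riesz_def[of y p] riesz_def[of y q]
    by (simp add: sum_product riesz_sum mult_single assms algebra_simps)
  finally show ?thesis .
qed

text \<open>Evaluation is integration against a point mass, so its ring laws are inherited from
  those of \<open>riesz\<close>.\<close>

lemma peval_eq_riesz: "peval p z = riesz (\<lambda>\<alpha>. monom_eval \<alpha> z) p"
  by (simp add: peval_def riesz_def monom_eval_def)

lemma peval_add: "peval (p + q) z = peval p z + peval q z"
  by (simp add: peval_eq_riesz riesz_add)

lemma peval_diff: "peval (p - q) z = peval p z - peval q z"
  by (simp add: peval_eq_riesz riesz_diff)

lemma peval_sum: "peval (\<Sum>i\<in>I. p i) z = (\<Sum>i\<in>I. peval (p i) z)"
  by (simp add: peval_eq_riesz riesz_sum)

lemma peval_mult: "peval (p * q) z = peval p z * peval q z"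
  by (simp add: peval_eq_riesz riesz_mult monom_eval_add)

lemma peval_const_poly: "peval (const_poly c) z = c"
  by (simp add: peval_eq_riesz const_poly_def)

lemma peval_var_poly: "peval (var_poly k) z = z k"
  by (simp add: peval_eq_riesz var_poly_def monom_eval_def)

lemma peval_monom_poly: "peval (monom_poly \<alpha>) z = monom_eval \<alpha> z"
  by (simp add: peval_eq_riesz monom_poly_def)

lemma peval_cong:
  assumes "\<And>k. k \<in> poly_vars p \<Longrightarrow> z k = z' k"
  shows "peval p z = peval p z'"
  unfolding peval_eq_riesz
  using assms by (intro riesz_cong monom_eval_cong) (auto simp: poly_vars_def)

section \<open>Total degree\<close>

lemma monom_deg_superset:
  assumes "finite A" "Poly_Mapping.keys \<alpha> \<subseteq> A"
  shows "monom_deg \<alpha> = (\<Sum>k\<in>A. Poly_Mapping.lookup \<alpha> k)"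
  unfolding monom_deg_def using assms
  by (intro sum.mono_neutral_left) (auto simp: in_keys_iff)

lemma monom_deg_add: "monom_deg (\<alpha> + \<beta>) = monom_deg \<alpha> + monom_deg \<beta>"
proof -
  let ?A = "Poly_Mapping.keys \<alpha> \<union> Poly_Mapping.keys \<beta>"
  have "monom_deg (\<alpha> + \<beta>) = (\<Sum>k\<in>?A. Poly_Mapping.lookup (\<alpha> + \<beta>) k)"
    by (rule monom_deg_superset) (simp_all add: keys_add)
  then show ?thesis
    by (simp add: monom_deg_superset[of ?A] lookup_add sum.distrib)
qed

lemma poly_deg_le_iff: "poly_deg p \<le> d \<longleftrightarrow> (\<forall>\<alpha>\<in>Poly_Mapping.keys p. monom_deg \<alpha> \<le> d)"
  by (auto simp: poly_deg_def)

lemma poly_deg_mult_le: "poly_deg (p * q) \<le> poly_deg p + poly_deg q"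
  unfolding poly_deg_le_iff
proof
  fix \<gamma> assume "\<gamma> \<in> Poly_Mapping.keys (p * q)"
  then obtain \<alpha> \<beta> where "\<gamma> = \<alpha> + \<beta>" "\<alpha> \<in> Poly_Mapping.keys p" "\<beta> \<in> Poly_Mapping.keys q"
    using keys_mult[of p q] by auto
  then show "monom_deg \<gamma> \<le> poly_deg p + poly_deg q"
    using poly_deg_le_iff[of p "poly_deg p"] poly_deg_le_iff[of q "poly_deg q"]
    by (simp add: monom_deg_add add_mono)
qed

section \<open>Formal partial derivatives and the chain rule\<close>

lemma peval_partial_monom_poly:
  "peval (partial k (monom_poly \<alpha>)) z
     = real (Poly_Mapping.lookup \<alpha> k) * monom_eval (\<alpha> - Poly_Mapping.single k 1) z"
  by (simp add: partial_def monom_poly_def peval_eq_riesz)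

text \<open>The Leibniz rule is applied to the factors
  \<open>z s k ^ Poly_Mapping.lookup \<alpha> k\<close>; the summand in which factor
  \<open>k\<close> is differentiated is the formal partial derivative times
  \<open>d k\<close>.\<close>

lemma monom_eval_has_real_derivative:
  assumes "\<And>k. k \<in> Poly_Mapping.keys \<alpha> \<Longrightarrow> ((\<lambda>s. z s k) has_real_derivative d k) (at t within S)"
  shows "((\<lambda>s. monom_eval \<alpha> (z s)) has_real_derivative
      (\<Sum>k\<in>Poly_Mapping.keys \<alpha>. peval (partial k (monom_poly \<alpha>)) (z t) * d k)) (at t within S)"
proof -
  let ?K = "Poly_Mapping.keys \<alpha>" and ?n = "Poly_Mapping.lookup \<alpha>"
  have "((\<lambda>s. \<Prod>k\<in>?K. z s k ^ ?n k) has_derivative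
      (\<lambda>h. \<Sum>k\<in>?K. (h * (real (?n k) * (d k * z t k ^ (?n k - 1)))) * (\<Prod>j\<in>?K - {k}. z t j ^ ?n j)))
      (at t within S)"
  proof (rule has_derivative_prod)
    fix k assume "k \<in> ?K"
    from DERIV_power[OF assms[OF this], of "?n k"]
    show "((\<lambda>s. z s k ^ ?n k) has_derivative
        (\<lambda>h. h * (real (?n k) * (d k * z t k ^ (?n k - 1))))) (at t within S)"
      unfolding has_field_derivative_def
      by (rule has_derivative_eq_rhs) (auto simp: fun_eq_iff)
  qed
  moreover have *: "real (?n k) * (d k * z t k ^ (?n k - 1)) * (\<Prod>j\<in>?K - {k}. z t j ^ ?n j)
      = peval (partial k (monom_poly \<alpha>)) (z t) * d k" if "k \<in> ?K" for k
  proof -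
    let ?\<beta> = "\<alpha> - Poly_Mapping.single k 1"
    \<comment> \<open>Lowering an exponent 1 removes \<open>k\<close> from the keys, so the product
      is taken over the keys of \<alpha> before factor \<open>k\<close> is split off.\<close>
    have "Poly_Mapping.keys ?\<beta> \<subseteq> ?K"
      by (auto simp: in_keys_iff lookup_minus)
    then have "monom_eval ?\<beta> (z t) = (\<Prod>j\<in>?K. z t j ^ Poly_Mapping.lookup ?\<beta> j)"
      by (intro monom_eval_superset) auto
    also have "\<dots> = z t k ^ (?n k - 1) * (\<Prod>j\<in>?K - {k}. z t j ^ ?n j)"
      using that
      by (subst prod.remove[of _ k]) (auto simp: lookup_minus lookup_single when_def intro!: prod.cong)
    finally show ?thesis by (simp add: peval_partial_monom_poly)
  qed
  moreover have "(\<Sum>k\<in>?K. h * (real (?n k) * (d k * z t k ^ (?n k - 1))) * (\<Prod>j\<in>?K - {k}. z t j ^ ?n j))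
      = (\<Sum>k\<in>?K. peval (partial k (monom_poly \<alpha>)) (z t) * d k) * h" for h
  proof -
    have "(\<Sum>k\<in>?K. h * (real (?n k) * (d k * z t k ^ (?n k - 1))) * (\<Prod>j\<in>?K - {k}. z t j ^ ?n j))
        = (\<Sum>k\<in>?K. h * (peval (partial k (monom_poly \<alpha>)) (z t) * d k))"
      by (intro sum.cong refl) (simp only: mult.assoc[of h] *)
    also have "\<dots> = h * (\<Sum>k\<in>?K. peval (partial k (monom_poly \<alpha>)) (z t) * d k)"
      by (rule sum_distrib_left[symmetric])
    finally show ?thesis
      by (simp only: mult.commute)
  qed
  ultimately show ?thesis
    by (simp only: has_field_derivative_def monom_eval_def)
qed

section \<open>Moments of admissible pairs\<close>

lemma monom_eval_ess_bounded:
  assumes meas: "\<And>k. (\<lambda>t. z t k) \<in> borel_measurable M"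
    and bdd: "\<And>k. AE t in M. \<bar>z t k\<bar> \<le> B"
  shows "(\<lambda>t. monom_eval \<alpha> (z t)) \<in> borel_measurable M"
    and "AE t in M. norm (monom_eval \<alpha> (z t)) \<le> B ^ monom_deg \<alpha>"
proof -
  show "(\<lambda>t. monom_eval \<alpha> (z t)) \<in> borel_measurable M"
    unfolding monom_eval_def by (intro borel_measurable_prod borel_measurable_power meas)
  have "AE t in M. \<forall>k\<in>Poly_Mapping.keys \<alpha>. \<bar>z t k\<bar> \<le> B"
    using bdd by (intro AE_finite_allI) auto
  then show "AE t in M. norm (monom_eval \<alpha> (z t)) \<le> B ^ monom_deg \<alpha>"
  proof (rule eventually_mono)
    fix t assume B: "\<forall>k\<in>Poly_Mapping.keys \<alpha>. \<bar>z t k\<bar> \<le> B"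
    have "norm (monom_eval \<alpha> (z t)) \<le> (\<Prod>k\<in>Poly_Mapping.keys \<alpha>. B ^ Poly_Mapping.lookup \<alpha> k)"
      unfolding monom_eval_def real_norm_def abs_prod power_abs
      using B by (intro prod_mono) (auto intro: power_mono)
    then show "norm (monom_eval \<alpha> (z t)) \<le> B ^ monom_deg \<alpha>"
      by (simp add: monom_deg_def power_sum)
  qed
qed

text \<open>Compactness of the constraint sets bounds control and state, and the interval bounds
  time. Each monomial is thus measurable and essentially bounded on a space of finite
  measure.\<close>

lemma integrable_monom_eval_admissible:
  fixes P :: "('m::finite, 'n::finite) ocp"
  assumes adm: "admissible P u x" and U: "compact (U_set P)" and X: "compact (X_set P)"
  shows "integrable (lebesgue_on {t_init P..t_final P}) (\<lambda>t. monom_eval \<alpha> (point t (u t) (x t)))"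
proof -
  let ?S = "{t_init P..t_final P}"
  let ?M = "lebesgue_on ?S"
  obtain Bu Bx where Bu: "\<And>v. v \<in> U_set P \<Longrightarrow> norm v \<le> Bu"
    and Bx: "\<And>v. v \<in> X_set P \<Longrightarrow> norm v \<le> Bx"
    using compact_imp_bounded[OF U] compact_imp_bounded[OF X] unfolding bounded_iff by blast
  define B where "B = max (max \<bar>t_init P\<bar> \<bar>t_final P\<bar>) (max Bu Bx)"
  have u: "u \<in> borel_measurable ?M" "AE t in ?M. u t \<in> U_set P"
    and x: "continuous_on ?S x" "\<And>t. t \<in> ?S \<Longrightarrow> x t \<in> X_set P"
    using adm absolutely_continuous_on_interval_imp_continuous_on unfolding admissible_def by blast+
  have meas: "(\<lambda>t. point t (u t) (x t) k) \<in> borel_measurable ?M" for k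
  proof (cases k)
    case Time
    show ?thesis
      unfolding Time point.simps
      by (rule continuous_imp_measurable_on_sets_lebesgue) (auto intro: continuous_intros)
  next
    case (Control i)
    have "(\<lambda>v. v $ i) \<in> borel_measurable (borel :: (real ^ 'm) measure)"
      by (intro borel_measurable_continuous_onI continuous_intros)
    from measurable_compose[OF u(1) this] show ?thesis
      by (simp add: Control)
  next
    case (State i)
    show ?thesis
      unfolding State point.simps
      by (rule continuous_imp_measurable_on_sets_lebesgue) (auto intro: continuous_intros x(1))
  qed
  have bdd: "AE t in ?M. \<bar>point t (u t) (x t) k\<bar> \<le> B" for k
  \<comment> \<open>The control constraint holds only almost everywhere, the state constraint at
    every time.\<close>
  proof (rule lebesgue_on_mono[OF u(2)])
    fix t assume t: "u t \<in> U_set P" "t \<in> ?S"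
    show "\<bar>point t (u t) (x t) k\<bar> \<le> B"
    proof (cases k)
      case Time
      then show ?thesis using t(2) by (auto simp: B_def)
    next
      case (Control i)
      then show ?thesis using component_le_norm_cart[of "u t" i] Bu[OF t(1)] by (auto simp: B_def)
    next
      case (State i)
      then show ?thesis using component_le_norm_cart[of "x t" i] Bx[OF x(2)[OF t(2)]] by (auto simp: B_def)
    qed
  qed
  have "finite_measure ?M"
    by (intro finite_measure_lebesgue_on) auto
  then show ?thesis
    using monom_eval_ess_bounded[OF meas bdd] by (intro finite_measure.integrable_const_bound) auto
qed

text \<open>The moments of the occupation measure, written as time integrals so that the image
  measure need not be formed. No degree bound is imposed yet.\<close>

definition moments :: "('m::finite, 'n::finite) ocp \<Rightarrow> (real \<Rightarrow> real ^ 'm) \<Rightarrow> (real \<Rightarrow> real ^ 'n)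
    \<Rightarrow> ('m, 'n) coord monomial \<Rightarrow> real" where
  "moments P u x \<alpha> = (LINT t|lebesgue_on {t_init P..t_final P}. monom_eval \<alpha> (point t (u t) (x t)))"

lemma
  assumes "admissible P u x" "compact (U_set P)" "compact (X_set P)"
  shows integrable_peval_admissible:
      "integrable (lebesgue_on {t_init P..t_final P}) (\<lambda>t. peval p (point t (u t) (x t)))"
    and riesz_moments:
      "riesz (moments P u x) p = (LINT t|lebesgue_on {t_init P..t_final P}. peval p (point t (u t) (x t)))"
  unfolding peval_eq_riesz riesz_def moments_def
  using integrable_monom_eval_admissible[OF assms] by (simp_all add: integral_sum)

section \<open>Constraints and dynamics along admissible pairs\<close>

lemma peval_T_poly: "peval (T_poly P) z = (z Time - t_init P) * (t_final P - z Time)"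
  by (simp add: T_poly_def peval_mult peval_diff peval_const_poly peval_var_poly)

text \<open>An inequality of one constraint set involves only its own indeterminates, so replacing
  the other coordinates by the zeros used in \<open>U_set\<close> and \<open>X_set\<close> does not
  change its value.\<close>

lemma peval_constraint_nonneg:
  assumes U: "\<forall>g\<in>U_ineqs P. poly_vars g \<subseteq> range Control"
    and X: "\<forall>g\<in>X_ineqs P. poly_vars g \<subseteq> range State"
    and "t \<in> {t_init P..t_final P}" "v \<in> U_set P" "w \<in> X_set P" "g \<in> constraint_polys P"
  shows "0 \<le> peval g (point t v w)"
proof -
  consider "g \<in> U_ineqs P" | "g \<in> X_ineqs P" | "g = T_poly P"
    using assms(6) by (auto simp: constraint_polys_def)
  then show ?thesis
  proof cases
    case 1
    then have "peval g (point t v w) = peval g (point 0 v 0)"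
      using U by (intro peval_cong) force
    then show ?thesis using 1 assms(4) by (simp add: U_set_def)
  next
    case 2
    then have "peval g (point t v w) = peval g (point 0 0 w)"
      using X by (intro peval_cong) force
    then show ?thesis using 2 assms(5) by (simp add: X_set_def)
  next
    case 3
    then show ?thesis using assms(3) by (simp add: peval_T_poly)
  qed
qed

text \<open>By the differential equation, the integrand is almost everywhere the total time
  derivative of the monomial along the trajectory, so its integral is the difference of the boundary
  values.\<close>

lemma integral_liouville:
  fixes P :: "('m::finite, 'n::finite) ocp"
  assumes "t_init P \<le> t_final P" and adm: "admissible P u x"
    and UX: "compact (U_set P)" "compact (X_set P)"
    and \<alpha>: "Poly_Mapping.keys \<alpha> \<subseteq> insert Time (range State)"
  shows "(LINT t|lebesgue_on {t_init P..t_final P}. peval (liouville P (monom_poly \<alpha>)) (point t (u t) (x t)))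
    = monom_eval \<alpha> (point (t_final P) 0 (x_final P)) - monom_eval \<alpha> (point (t_init P) 0 (x_init P))"
proof -
  let ?S = "{t_init P..t_final P}"
  define F where "F t = (\<chi> i. peval (dyn_poly P i) (point t (u t) (x t)))" for t
  \<comment> \<open>\<alpha> has no control exponents; the placeholder 0 keeps the merely measurable
    control out of a function that must be absolutely continuous.\<close>
  define w where "w t = monom_eval \<alpha> (point t 0 (x t))" for t
  let ?D = "\<lambda>t. peval (liouville P (monom_poly \<alpha>)) (point t (u t) (x t))"
  have ac: "absolutely_continuous_on_interval (t_init P) (t_final P) x"
    and ends: "x (t_init P) = x_init P" "x (t_final P) = x_final P"
    and "AE t in lebesgue_on ?S. (x has_vector_derivative F t) (at t within ?S)"
    using adm by (auto simp: admissible_def F_def)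
  then have "AE t in lebesgue. t \<in> ?S \<longrightarrow> (x has_vector_derivative F t) (at t within ?S)"
    by (subst (asm) AE_restrict_space_iff) auto
  then obtain N where N: "negligible N"
    and deriv: "\<And>t. t \<in> ?S - N \<Longrightarrow> (x has_vector_derivative F t) (at t within ?S)"
    unfolding eventually_ae_filter negligible_iff_null_sets by auto
  have "absolutely_continuous_on_interval (t_init P) (t_final P) w"
    unfolding w_def monom_eval_def
  proof (intro absolutely_continuous_on_interval_prod absolutely_continuous_on_interval_power)
    show "absolutely_continuous_on_interval (t_init P) (t_final P) (\<lambda>t. point t 0 (x t) k)" for k :: "('m, 'n) coord"
      by (cases k) (simp_all add: absolutely_continuous_on_interval_ident
          absolutely_continuous_on_interval_const absolutely_continuous_on_interval_vec_nth[OF ac])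
  qed
  moreover have "(w has_vector_derivative ?D t) (at t within ?S)" if t: "t \<in> ?S - N" for t
  proof -
    \<comment> \<open>Freezing the control at \<open>u t\<close> leaves \<open>w\<close> unchanged and puts the chain rule at the right point.\<close>
    let ?z = "\<lambda>s. point s (u t) (x s)"
    let ?v = "monom_poly \<alpha> :: ('m, 'n) coord mpoly"
    define d where "d = point 1 (0 :: real ^ 'm) (F t)"
    have w: "w = (\<lambda>s. monom_eval \<alpha> (?z s))"
      unfolding w_def using \<alpha> by (intro ext monom_eval_cong) auto
    have comp: "((\<lambda>s. x s $ i) has_real_derivative F t $ i) (at t within ?S)" for i
      using bounded_linear.has_vector_derivative[OF bounded_linear_vec_nth deriv[OF t]]
      by (simp add: has_real_derivative_iff_has_vector_derivative)
    have "((\<lambda>s. ?z s k) has_real_derivative d k) (at t within ?S)" for k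
      by (cases k) (auto simp: d_def intro: comp)
    then have "(w has_real_derivative
        (\<Sum>k\<in>Poly_Mapping.keys \<alpha>. peval (partial k ?v) (?z t) * d k)) (at t within ?S)"
      unfolding w by (rule monom_eval_has_real_derivative)
    moreover have "(\<Sum>k\<in>Poly_Mapping.keys \<alpha>. peval (partial k ?v) (?z t) * d k) = ?D t"
    proof -
      \<comment> \<open>The coordinates added to the index set have exponent 0 in \<alpha>, so their
        partial derivatives vanish.\<close>
      have "(\<Sum>k\<in>Poly_Mapping.keys \<alpha>. peval (partial k ?v) (?z t) * d k)
          = (\<Sum>k\<in>insert Time (range State). peval (partial k ?v) (?z t) * d k)"
        using \<alpha> by (intro sum.mono_neutral_left) (auto simp: peval_partial_monom_poly in_keys_iff)
      also have "\<dots> = peval (partial Time ?v) (?z t) + (\<Sum>i\<in>UNIV. peval (partial (State i) ?v) (?z t) * F t $ i)"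
        by (subst sum.insert) (auto simp: d_def sum.reindex inj_def)
      also have "\<dots> = ?D t"
        by (simp add: liouville_def peval_add peval_sum peval_mult F_def)
      finally show ?thesis .
    qed
    ultimately show ?thesis
      by (simp add: has_real_derivative_iff_has_vector_derivative)
  qed
  ultimately have "(?D has_integral (w (t_final P) - w (t_init P))) ?S"
    by (rule fundamental_theorem_of_calculus_absolutely_continuous[OF assms(1) _ N])
  \<comment> \<open>The fundamental theorem yields a gauge integral, whereas moments are Lebesgue
    integrals; uniqueness of the gauge integral identifies the two values.\<close>
  moreover have "(?D has_integral (LINT t|lebesgue_on ?S. ?D t)) ?S"
    by (intro has_integral_integral_lebesgue_on integrable_peval_admissible adm UX) auto
  ultimately have "(LINT t|lebesgue_on ?S. ?D t) = w (t_final P) - w (t_init P)"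
    by (rule has_integral_unique[rotated])
  then show ?thesis
    by (simp add: w_def ends)
qed

text \<open>The moments are cut off at degree \<open>2 * r\<close> to fit the index set of the
  relaxation. Each condition tests only polynomials up to that degree, on which \<open>riesz\<close>
  is still integration along the pair.\<close>

lemma moments_feasible:
  assumes "t_init P \<le> t_final P"
    and vars: "\<forall>g\<in>U_ineqs P. poly_vars g \<subseteq> range Control" "\<forall>g\<in>X_ineqs P. poly_vars g \<subseteq> range State"
    and UX: "compact (U_set P)" "compact (X_set P)"
    and deg: "\<forall>g\<in>constraint_polys P. poly_deg g \<le> 2 * r"
    and adm: "admissible P u x"
  shows "restrict (moments P u x) {\<alpha>. monom_deg \<alpha> \<le> 2 * r} \<in> moment_feasible P r"
proof -
  let ?M = "lebesgue_on {t_init P..t_final P}"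
  let ?y = "restrict (moments P u x) {\<alpha>. monom_deg \<alpha> \<le> 2 * r}"
  have y: "riesz ?y p = (LINT t|?M. peval p (point t (u t) (x t)))" if "poly_deg p \<le> 2 * r" for p
  proof -
    have "riesz ?y p = riesz (moments P u x) p"
      using that by (intro riesz_cong) (simp add: poly_deg_le_iff)
    then show ?thesis by (simp add: riesz_moments[OF adm UX])
  qed
  have "riesz ?y (liouville P (monom_poly \<alpha>)) =
      peval (monom_poly \<alpha>) (point (t_final P) 0 (x_final P)) - peval (monom_poly \<alpha>) (point (t_init P) 0 (x_init P))"
    if "Poly_Mapping.keys \<alpha> \<subseteq> insert Time (range State)" "poly_deg (liouville P (monom_poly \<alpha>)) \<le> 2 * r" for \<alpha>
    using y[OF that(2)] integral_liouville[OF assms(1) adm UX that(1)] by (simp add: peval_monom_poly)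
  moreover have "0 \<le> riesz ?y (p\<^sup>2)" if "poly_deg p \<le> r" for p
  proof -
    have "poly_deg (p\<^sup>2) \<le> 2 * r"
      using poly_deg_mult_le[of p p] that by (simp add: power2_eq_square)
    then show ?thesis
      by (simp add: y power2_eq_square peval_mult)
  qed
  moreover have "0 \<le> riesz ?y (g * p\<^sup>2)"
    if g: "g \<in> constraint_polys P" and p: "poly_deg p \<le> r - nat \<lceil>real (poly_deg g) / 2\<rceil>" for g p
  proof -
    \<comment> \<open>The first bound leaves room for \<open>p\<^sup>2\<close> next to
      \<open>g\<close>; the second ensures that the natural-number subtraction from \<open>r\<close>
      does not truncate.\<close>
    have "poly_deg g \<le> 2 * nat \<lceil>real (poly_deg g) / 2\<rceil>" "nat \<lceil>real (poly_deg g) / 2\<rceil> \<le> r"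
      using deg g by (auto simp: nat_le_iff ceiling_le_iff) linarith
    then have "poly_deg (g * p\<^sup>2) \<le> 2 * r"
      using poly_deg_mult_le[of g "p\<^sup>2"] poly_deg_mult_le[of p p] p by (simp add: power2_eq_square)
    moreover have "0 \<le> (LINT t|?M. peval (g * p\<^sup>2) (point t (u t) (x t)))"
    proof (rule integral_nonneg_AE)
      have "AE t in ?M. u t \<in> U_set P" and x: "\<And>t. t \<in> {t_init P..t_final P} \<Longrightarrow> x t \<in> X_set P"
        using adm by (auto simp: admissible_def)
      then show "AE t in ?M. 0 \<le> peval (g * p\<^sup>2) (point t (u t) (x t))"
      proof (elim lebesgue_on_mono)
        fix t assume "u t \<in> U_set P" "t \<in> {t_init P..t_final P}"
        then have "0 \<le> peval g (point t (u t) (x t))"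
          using peval_constraint_nonneg[OF vars _ _ _ g] x by blast
        then show "0 \<le> peval (g * p\<^sup>2) (point t (u t) (x t))"
          by (simp add: peval_mult power2_eq_square)
      qed
    qed
    ultimately show ?thesis by (simp add: y)
  qed
  ultimately show ?thesis
    by (simp add: moment_feasible_def Let_def)
qed

text \<open>The cut-off moments are feasible, and since the cost polynomial has degree at most
  \<open>2 * r\<close>, their relaxed objective is the true cost.\<close>

lemma J_SDP_le_cost:
  assumes "t_init P \<le> t_final P"
    and "\<forall>g\<in>U_ineqs P. poly_vars g \<subseteq> range Control" "\<forall>g\<in>X_ineqs P. poly_vars g \<subseteq> range State"
    and UX: "compact (U_set P)" "compact (X_set P)"
    and deg: "poly_deg (cost_poly P) \<le> 2 * r"
    and "\<forall>g\<in>constraint_polys P. poly_deg g \<le> 2 * r"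
    and adm: "admissible P u x"
  shows "J_SDP P r \<le> ereal (cost P u x)"
proof -
  let ?y = "restrict (moments P u x) {\<alpha>. monom_deg \<alpha> \<le> 2 * r}"
  have "riesz ?y (cost_poly P) = riesz (moments P u x) (cost_poly P)"
    using deg by (intro riesz_cong) (simp add: poly_deg_le_iff)
  also have "\<dots> = cost P u x"
    by (simp add: riesz_moments[OF adm UX] cost_def)
  finally show ?thesis
    unfolding J_SDP_def
    using INF_lower[OF moments_feasible[OF assms(1-5,7,8)], of "\<lambda>y. ereal (riesz y (cost_poly P))"] by simp
qed

theorem corollary1:
  fixes P :: "('m::finite, 'n::finite) ocp"
    and u :: "real \<Rightarrow> real ^ 'm"
    and x :: "real \<Rightarrow> real ^ 'n"
    and r :: nat
  assumes "t_init P < t_final P"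
    and "finite (U_ineqs P)" and "\<forall>g\<in>U_ineqs P. poly_vars g \<subseteq> range Control"
    and "finite (X_ineqs P)" and "\<forall>g\<in>X_ineqs P. poly_vars g \<subseteq> range State"
    and "compact (U_set P)" and "compact (X_set P)"
    and "\<exists>c \<rho>. \<rho> > 0 \<and> control_ball_poly c \<rho> \<in> U_ineqs P"
    and "\<exists>c \<rho>. \<rho> > 0 \<and> state_ball_poly c \<rho> \<in> X_ineqs P"
    and "poly_deg (cost_poly P) \<le> 2 * r"
    and "\<forall>g\<in>constraint_polys P. poly_deg g \<le> 2 * r"
    and "admissible P u x"
    and "ereal (cost P u x) = J_SDP P r"
  shows "globally_optimal P u x"
proof -
  \<comment> \<open>The bound holds for every admissible competitor, so it passes to the infimum.
    With the assumed equality, \<open>J_opt P\<close> is squeezed between two equal values.\<close>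
  have "J_SDP P r \<le> J_opt P"
    unfolding J_opt_def
    using J_SDP_le_cost[OF less_imp_le[OF assms(1)] assms(3,5-7,10,11)] by (auto intro!: Inf_greatest)
  moreover have "J_opt P \<le> ereal (cost P u x)"
    unfolding J_opt_def using assms(12) by (auto intro!: Inf_lower)
  ultimately show ?thesis
    using assms(12,13) by (simp add: globally_optimal_def)
qed

end
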